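(* Let $L$ be a complex Leibniz algebra, let $I$ be the ideal generated by all squares $[x,x]$, $x\in L$, and suppose $L/I\cong\mathfrak{e}(2)$ and $I$, as a right $\mathfrak{e}(2)$-module via $(i,x+I)\mapsto[i,x]$, is isomorphic to the four-dimensional module with basis $X_1,\dots,X_4$ and action $(X_1,p_+)=X_3$, $(X_1,p_-)=-X_4$, $(X_2,p_-)=-X_3$, $(X_1,l)=\tfrac12X_1$, $(X_2,l)=-\tfrac32X_2$, $(X_3,l)=-\tfrac12X_3$, $(X_4,l)=\tfrac32X_4$ (all other products zero). Then there exists a basis $\{l,p_+,p_-,X_1,X_2,X_3,X_4\}$ of $L$ (with $X_i\in I$) in which the only nonzero products are $[l,p_+]=p_+$, $[p_+,l]=-p_+$, $[l,p_-]=-p_-$, $[p_-,l]=p_-$, $[X_1,p_+]=X_3$, $[X_1,p_-]=-X_4$, $[X_2,p_-]=-X_3$, $[X_1,l]=\tfrac12X_1$, $[X_2,l]=-\tfrac32X_2$, $[X_3,l]=-\tfrac12X_3$, $[X_4,l]=\tfrac32X_4$.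
   Context: A (right) Leibniz algebra is a vector space $L$ with a bilinear bracket satisfying $[[x,y],z]=[[x,z],y]+[x,[y,z]]$. The ideal $I$ generated by squares satisfies $[L,I]=0$, so $L/I$ is a Lie algebra and $I$ is a right $L/I$-module via $(i,x+I)\mapsto[i,x]$. $\mathfrak{e}(2)$ is the complex Lie algebra with basis $\{l,p_+,p_-\}$ and brackets $[l,p_+]=p_+$, $[l,p_-]=-p_-$, $[p_+,p_-]=0$. *)

theory Defs
  imports "HOL-Analysis.Analysis"
begin

text \<open>A complex vector space is a type 'a with an abstract scalar multiplication
  sc :: complex => 'a => 'a satisfying the vector_space axioms.\<close>

definition bilinear_sc :: "(complex \<Rightarrow> 'a::ab_group_add \<Rightarrow> 'a) \<Rightarrow> ('a \<Rightarrow> 'a \<Rightarrow> 'a) \<Rightarrow> bool" where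
  "bilinear_sc sc br \<longleftrightarrow>
     (\<forall>x. Vector_Spaces.linear sc sc (br x)) \<and> (\<forall>y. Vector_Spaces.linear sc sc (\<lambda>x. br x y))"

text \<open>Complex right Leibniz algebra: [[x,y],z] = [[x,z],y] + [x,[y,z]].\<close>
definition leibniz_algebra :: "(complex \<Rightarrow> 'a::ab_group_add \<Rightarrow> 'a) \<Rightarrow> ('a \<Rightarrow> 'a \<Rightarrow> 'a) \<Rightarrow> bool" where
  "leibniz_algebra sc br \<longleftrightarrow> vector_space sc \<and> bilinear_sc sc br \<and>
     (\<forall>x y z. br (br x y) z = br (br x z) y + br x (br y z))"

text \<open>Two-sided ideal.\<close>
definition is_ideal :: "(complex \<Rightarrow> 'a::ab_group_add \<Rightarrow> 'a) \<Rightarrow> ('a \<Rightarrow> 'a \<Rightarrow> 'a) \<Rightarrow> 'a set \<Rightarrow> bool" where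
  "is_ideal sc br J \<longleftrightarrow> module.subspace sc J \<and> (\<forall>j\<in>J. \<forall>x. br j x \<in> J \<and> br x j \<in> J)"

text \<open>The ideal generated by all squares [x,x].\<close>
definition square_ideal :: "(complex \<Rightarrow> 'a::ab_group_add \<Rightarrow> 'a) \<Rightarrow> ('a \<Rightarrow> 'a \<Rightarrow> 'a) \<Rightarrow> 'a set" where
  "square_ideal sc br = \<Inter>{J. is_ideal sc br J \<and> (\<forall>x. br x x \<in> J)}"

text \<open>The Lie algebra e(2) modelled on complex^3, coordinates (l, p_+, p_-) = indices 1,2,3:
  [l,p_+] = p_+, [l,p_-] = -p_-, [p_+,p_-] = 0.\<close>
definition e2_br :: "complex^3 \<Rightarrow> complex^3 \<Rightarrow> complex^3" where
  "e2_br u v = vector [0, u$1 * v$2 - u$2 * v$1, u$3 * v$1 - u$1 * v$3]"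

text \<open>The four-dimensional right e(2)-module on complex^4 (coordinates X_1..X_4 = indices 1..4):
  (X1,p+)=X3, (X1,p-)=-X4, (X2,p-)=-X3, (X1,l)=1/2 X1, (X2,l)=-3/2 X2,
  (X3,l)=-1/2 X3, (X4,l)=3/2 X4, all others zero.\<close>
definition M4_act :: "complex^4 \<Rightarrow> complex^3 \<Rightarrow> complex^4" where
  "M4_act x g = vector
     [ (1/2) * g$1 * x$1,
       -(3/2) * g$1 * x$2,
       g$2 * x$1 - g$3 * x$2 - (1/2) * g$1 * x$3,
       - g$3 * x$1 + (3/2) * g$1 * x$4 ]"

text \<open>Target multiplication table on a basis b 0, ..., b 6 = l, p_+, p_-, X_1, X_2, X_3, X_4.\<close>
definition target_table :: "(complex \<Rightarrow> 'a::ab_group_add \<Rightarrow> 'a) \<Rightarrow> (nat \<Rightarrow> 'a) \<Rightarrow> nat \<Rightarrow> nat \<Rightarrow> 'a" where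
  "target_table sc b i j =
    (if (i, j) = (0, 1) then b 1
     else if (i, j) = (1, 0) then - b 1
     else if (i, j) = (0, 2) then - b 2
     else if (i, j) = (2, 0) then b 2
     else if (i, j) = (3, 1) then b 5
     else if (i, j) = (3, 2) then - b 6
     else if (i, j) = (4, 2) then - b 5
     else if (i, j) = (3, 0) then sc (1/2) (b 3)
     else if (i, j) = (4, 0) then sc (-(3/2)) (b 4)
     else if (i, j) = (5, 0) then sc (-(1/2)) (b 5)
     else if (i, j) = (6, 0) then sc (3/2) (b 6)
     else 0)"

end

theory Submission
  imports Defs
begin

text \<open>
  In a right Leibniz algebra left multiplication by the square ideal \<open>I\<close> vanishes, so the
  products are governed by \<open>L/I \<cong> \<frak>e(2)\<close> and the module \<open>I\<close>, on which right multiplication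
  by a lift of \<open>l\<close> acts diagonally with weights \<open>1/2, -3/2, -1/2, 3/2\<close>. This action is
  invertible, so \<open>l\<close> can be corrected by an element of \<open>I\<close> to satisfy \<open>[l,l] = 0\<close>; the lifts
  of \<open>p\<^sub>\<plusminus>\<close> are then chosen as eigenvectors of left multiplication by \<open>l\<close>. Right multiplication
  by \<open>l\<close> is a derivation, so \<open>[p\<^sub>+,p\<^sub>+]\<close>, \<open>[p\<^sub>+,p\<^sub>-]\<close>, \<open>[p\<^sub>-,p\<^sub>+]\<close>, \<open>[p\<^sub>-,p\<^sub>-]\<close> are elements
  of \<open>I\<close> of weight \<open>-2\<close>, \<open>0\<close>, \<open>0\<close>, \<open>2\<close>, which do not occur; hence they vanish.
\<close>

lemma (in module) unique_coefficients_imp_inj_on: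
  fixes b :: "'i \<Rightarrow> 'b"
  assumes "finite A" and unique: "\<And>c. (\<Sum>k\<in>A. scale (c k) (b k)) = 0 \<Longrightarrow> \<forall>k\<in>A. c k = 0"
  shows "inj_on b A"
proof (rule inj_onI, rule ccontr)
  fix i j assume i: "i \<in> A" and j: "j \<in> A" and "b i = b j" "i \<noteq> j"
  define c :: "'i \<Rightarrow> 'a" where "c k = (if k = i then 1 else if k = j then -1 else 0)" for k
  have "scale (c k) (b k) = (if k = i then b k else 0) - (if k = j then b k else 0)" for k
    using \<open>i \<noteq> j\<close> by (simp add: c_def)
  then have "(\<Sum>k\<in>A. scale (c k) (b k)) = b i - b j"
    using \<open>finite A\<close> i j by (simp add: sum_subtractf)
  with \<open>b i = b j\<close> have "\<forall>k\<in>A. c k = 0" by (intro unique) simp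
  then have "c i = 0" using i by blast
  then show False by (simp add: c_def)
qed

lemma (in module) unique_coefficients_imp_independent:
  fixes b :: "'i \<Rightarrow> 'b"
  assumes "finite A" and unique: "\<And>c. (\<Sum>k\<in>A. scale (c k) (b k)) = 0 \<Longrightarrow> \<forall>k\<in>A. c k = 0"
  shows "independent (b ` A)"
proof
  assume "dependent (b ` A)"
  then obtain u where u: "\<exists>v\<in>b ` A. u v \<noteq> 0" "(\<Sum>v\<in>b ` A. scale (u v) v) = 0"
    using \<open>finite A\<close> dependent_finite[of "b ` A"] by auto
  have "inj_on b A" using assms by (rule unique_coefficients_imp_inj_on)
  then have "(\<Sum>k\<in>A. scale (u (b k)) (b k)) = 0"
    using u(2) by (simp add: sum.reindex)
  then have "\<forall>k\<in>A. u (b k) = 0" by (rule unique)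
  with u(1) show False by auto
qed

lemma leibniz_algebra_module_hom:
  assumes "leibniz_algebra sc br"
  shows "module_hom sc sc (br x)" and "module_hom sc sc (\<lambda>x. br x y)"
  using assms unfolding leibniz_algebra_def bilinear_sc_def linear_iff_module_hom by simp_all

lemma leibniz_identity:
  assumes "leibniz_algebra sc br"
  shows "br (br x y) z = br (br x z) y + br x (br y z)"
  using assms unfolding leibniz_algebra_def by blast

lemma leibniz_square_ideal_left_annihilates:
  assumes leib: "leibniz_algebra sc br" and i: "i \<in> square_ideal sc br"
  shows "br x i = 0"
proof -
  interpret vector_space sc using leib by (simp add: leibniz_algebra_def)
  define A where "A = {a. \<forall>y. br y a = 0}"
  note left = leibniz_algebra_module_hom(1)[OF leib]
    and right = leibniz_algebra_module_hom(2)[OF leib]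
  have "is_ideal sc br A"
    unfolding is_ideal_def subspace_def
  proof (intro conjI ballI allI)
    show "0 \<in> A" using module_hom.zero[OF left] by (simp add: A_def)
    show "a + b \<in> A" if "a \<in> A" "b \<in> A" for a b
      using that module_hom.add[OF left] by (simp add: A_def)
    show "sc c a \<in> A" if "a \<in> A" for c a
      using that module_hom.scale[OF left] by (simp add: A_def)
    show "br x a \<in> A" if "a \<in> A" for a x
      using that module_hom.zero[OF left] by (simp add: A_def)
    show "br a x \<in> A" if "a \<in> A" for a x
    proof -
      have "br y (br a x) = 0" for y
        using leibniz_identity[OF leib, of y a x] that module_hom.zero[OF right]
        by (simp add: A_def)
      then show ?thesis by (simp add: A_def)
    qed
  qed
  moreover have "br x x \<in> A" for x
  proof -
    have "br y (br x x) = 0" for y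
      using leibniz_identity[OF leib, of y x x] by (metis add_cancel_left_right)
    then show ?thesis by (simp add: A_def)
  qed
  ultimately have "square_ideal sc br \<subseteq> A"
    unfolding square_ideal_def by blast
  with i show ?thesis by (auto simp: A_def)
qed

lemma leibniz_weight_add:
  assumes leib: "leibniz_algebra sc br" and "br x l = sc \<alpha> x" and "br y l = sc \<beta> y"
  shows "br (br x y) l = sc (\<alpha> + \<beta>) (br x y)"
proof -
  interpret vector_space sc using leib by (simp add: leibniz_algebra_def)
  have "br (br x y) l = br (sc \<alpha> x) y + br x (sc \<beta> y)"
    using leibniz_identity[OF leib, of x y l] assms(2,3) by simp
  also have "\<dots> = sc (\<alpha> + \<beta>) (br x y)"
    using module_hom.scale[OF leibniz_algebra_module_hom(1)[OF leib]]
      module_hom.scale[OF leibniz_algebra_module_hom(2)[OF leib]]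
    by (simp add: scale_left_distrib)
  finally show ?thesis .
qed

lemma vector_4 [simp]:
  "(vector [x, y, z, w] :: 'a::zero^4) $ 1 = x"
  "(vector [x, y, z, w] :: 'a::zero^4) $ 2 = y"
  "(vector [x, y, z, w] :: 'a::zero^4) $ 3 = z"
  "(vector [x, y, z, w] :: 'a::zero^4) $ 4 = w"
  unfolding vector_def by simp_all

lemma e2_br_nth [simp]:
  "e2_br u v $ 1 = 0"
  "e2_br u v $ 2 = u$1 * v$2 - u$2 * v$1"
  "e2_br u v $ 3 = u$3 * v$1 - u$1 * v$3"
  unfolding e2_br_def by simp_all

lemma M4_act_nth [simp]:
  "M4_act x g $ 1 = (1/2) * g$1 * x$1"
  "M4_act x g $ 2 = -(3/2) * g$1 * x$2"
  "M4_act x g $ 3 = g$2 * x$1 - g$3 * x$2 - (1/2) * g$1 * x$3"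
  "M4_act x g $ 4 = - g$3 * x$1 + (3/2) * g$1 * x$4"
  unfolding M4_act_def by simp_all

text \<open>The basis \<open>l, p\<^sub>+, p\<^sub>-\<close> of \<open>\<frak>e(2)\<close>.\<close>
abbreviation e2_l :: "complex^3" where "e2_l \<equiv> vector [1, 0, 0]"
abbreviation e2_pp :: "complex^3" where "e2_pp \<equiv> vector [0, 1, 0]"
abbreviation e2_pm :: "complex^3" where "e2_pm \<equiv> vector [0, 0, 1]"

lemma M4_act_l_eigenvalues:
  assumes "M4_act v e2_l = c *s v" and "v \<noteq> 0"
  shows "c \<in> {1/2, -3/2, -1/2, 3/2}"
proof -
  define w :: "4 \<Rightarrow> complex"
    where "w k = (if k = 1 then 1/2 else if k = 2 then -3/2 else if k = 3 then -1/2 else 3/2)" for k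
  have diagonal: "M4_act v e2_l $ k = w k * v $ k" for k
    using exhaust_4[of k] by (auto simp: w_def)
  have eigen: "c * v $ k = w k * v $ k" for k
    using assms(1) diagonal by (metis vector_scalar_mult_def vec_lambda_beta)
  obtain k where "v $ k \<noteq> 0" using \<open>v \<noteq> 0\<close> by (auto simp: vec_eq_iff)
  with eigen have "c = w k" by (metis mult_right_cancel)
  then show ?thesis by (simp add: w_def)
qed

lemma M4_act_l_surj: "\<exists>v. M4_act v e2_l = u"
proof
  show "M4_act (vector [2 * u$1, -(2/3) * u$2, -2 * u$3, (2/3) * u$4]) e2_l = u"
    by (simp add: vec_eq_iff forall_4)
qed

lemma less_7_cases: "k < (7::nat) \<Longrightarrow> k = 0 \<or> k = 1 \<or> k = 2 \<or> k = 3 \<or> k = 4 \<or> k = 5 \<or> k = 6"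
  by arith

locale leibniz_e2_M4 =
  fixes sc :: "complex \<Rightarrow> 'a::ab_group_add \<Rightarrow> 'a"
    and br :: "'a \<Rightarrow> 'a \<Rightarrow> 'a"
    and \<pi> :: "'a \<Rightarrow> complex^3"
    and \<phi> :: "'a \<Rightarrow> complex^4"
  assumes leibniz: "leibniz_algebra sc br"
    and linear_\<pi>: "Vector_Spaces.linear sc (*s) \<pi>"
    and surj_\<pi>: "surj \<pi>"
    and kernel_\<pi>: "{x. \<pi> x = 0} = square_ideal sc br"
    and \<pi>_br: "\<pi> (br x y) = e2_br (\<pi> x) (\<pi> y)"
    and bij_\<phi>: "bij_betw \<phi> (square_ideal sc br) UNIV"
    and \<phi>_add: "i \<in> square_ideal sc br \<Longrightarrow> j \<in> square_ideal sc br \<Longrightarrow> \<phi> (i + j) = \<phi> i + \<phi> j"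
    and \<phi>_scale: "i \<in> square_ideal sc br \<Longrightarrow> \<phi> (sc c i) = c *s \<phi> i"
    and \<phi>_br: "i \<in> square_ideal sc br \<Longrightarrow> \<phi> (br i x) = M4_act (\<phi> i) (\<pi> x)"
begin

sublocale \<Pi>: Vector_Spaces.linear sc "(*s)" \<pi>
  by (rule linear_\<pi>)

abbreviation I :: "'a set" where "I \<equiv> square_ideal sc br"

lemma mem_I_iff: "x \<in> I \<longleftrightarrow> \<pi> x = 0"
  using kernel_\<pi> by blast

lemmas br_left_hom = leibniz_algebra_module_hom(1)[OF leibniz]
  and br_right_hom = leibniz_algebra_module_hom(2)[OF leibniz]

lemma br_bilinear [simp]:
  "br (x + y) z = br x z + br y z" "br z (x + y) = br z x + br z y"
  "br (- x) z = - br x z" "br z (- x) = - br z x"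
  "br (x - y) z = br x z - br y z" "br z (x - y) = br z x - br z y"
  "br 0 z = 0" "br z 0 = 0"
  "br (sc c x) z = sc c (br x z)" "br z (sc c x) = sc c (br z x)"
  using module_hom.add[OF br_left_hom] module_hom.add[OF br_right_hom]
    module_hom.neg[OF br_left_hom] module_hom.neg[OF br_right_hom]
    module_hom.diff[OF br_left_hom] module_hom.diff[OF br_right_hom]
    module_hom.zero[OF br_left_hom] module_hom.zero[OF br_right_hom]
    module_hom.scale[OF br_left_hom] module_hom.scale[OF br_right_hom]
  by simp_all

lemma br_I_right: "i \<in> I \<Longrightarrow> br x i = 0"
  by (rule leibniz_square_ideal_left_annihilates[OF leibniz])

definition \<psi> :: "complex^4 \<Rightarrow> 'a" where "\<psi> = inv_into I \<phi>"

lemma \<psi>_in_I: "\<psi> v \<in> I"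
  unfolding \<psi>_def using bij_\<phi> by (metis bij_betw_imp_surj_on inv_into_into UNIV_I)

lemma \<phi>_\<psi> [simp]: "\<phi> (\<psi> v) = v"
  unfolding \<psi>_def using bij_\<phi> by (meson UNIV_I bij_betw_inv_into_right)

lemma \<psi>_\<phi>: "i \<in> I \<Longrightarrow> \<psi> (\<phi> i) = i"
  unfolding \<psi>_def using bij_\<phi> by (meson bij_betw_inv_into_left)

lemma \<psi>_eq_iff [simp]: "\<psi> u = \<psi> v \<longleftrightarrow> u = v"
  by (metis \<phi>_\<psi>)

lemma \<pi>_\<psi> [simp]: "\<pi> (\<psi> v) = 0"
  using \<psi>_in_I mem_I_iff by blast

lemma linear_\<psi>: "Vector_Spaces.linear (*s) sc \<psi>"
proof -
  have I_add: "i + j \<in> I" if "i \<in> I" "j \<in> I" for i j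
    using that by (simp add: mem_I_iff \<Pi>.add)
  have I_scale: "sc c i \<in> I" if "i \<in> I" for c i
    using that by (simp add: mem_I_iff \<Pi>.scale)
  have "\<psi> (u + v) = \<psi> u + \<psi> v" for u v
    by (metis \<phi>_\<psi> \<psi>_\<phi> \<phi>_add \<psi>_in_I I_add)
  moreover have "\<psi> (c *s v) = sc c (\<psi> v)" for c v
    by (metis \<phi>_\<psi> \<psi>_\<phi> \<phi>_scale \<psi>_in_I I_scale)
  ultimately show ?thesis
    by (intro linear_module_homI module_hom.intro module_hom_axioms.intro
        vec.vector_space_axioms[folded module_iff_vector_space]
        \<Pi>.vs1.vector_space_axioms[folded module_iff_vector_space]) simp_all
qed

sublocale \<Psi>: Vector_Spaces.linear "(*s)" sc \<psi>
  by (rule linear_\<psi>)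

lemma \<psi>_eq_0_iff [simp]: "\<psi> v = 0 \<longleftrightarrow> v = 0"
  using \<psi>_eq_iff[of v 0] \<Psi>.zero by simp

lemma br_\<psi>_left: "br (\<psi> v) x = \<psi> (M4_act v (\<pi> x))"
proof -
  have "br (\<psi> v) x \<in> I"
    by (simp add: mem_I_iff \<pi>_br vec_eq_iff forall_3)
  then show ?thesis
    by (metis \<psi>_\<phi> \<phi>_br \<psi>_in_I \<phi>_\<psi>)
qed

lemma br_\<psi>_right [simp]: "br x (\<psi> v) = 0"
  by (rule br_I_right[OF \<psi>_in_I])

lemma I_weight_vanishes:
  assumes i: "i \<in> I" and l: "\<pi> l = e2_l" and weight: "br i l = sc c i"
    and c: "c \<notin> {1/2, -3/2, -1/2, 3/2}"
  shows "i = 0"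
proof -
  have "\<psi> (M4_act (\<phi> i) e2_l) = \<psi> (c *s \<phi> i)"
    using br_\<psi>_left[of "\<phi> i" l] weight by (simp add: \<psi>_\<phi>[OF i] l \<Psi>.scale)
  then have "M4_act (\<phi> i) e2_l = c *s \<phi> i" by simp
  with c have "\<phi> i = 0" using M4_act_l_eigenvalues by blast
  then show "i = 0" using \<psi>_\<phi>[OF i] \<Psi>.zero by metis
qed

lemma exists_lift_l: "\<exists>l. \<pi> l = e2_l \<and> br l l = 0"
proof -
  obtain l0 where l0: "\<pi> l0 = e2_l" using surj_\<pi> by (metis surjD)
  have "br l0 l0 \<in> I" by (simp add: mem_I_iff \<pi>_br l0 vec_eq_iff forall_3)
  then have ll0: "br l0 l0 = \<psi> (\<phi> (br l0 l0))" by (simp add: \<psi>_\<phi>)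
  obtain v where v: "M4_act v e2_l = - \<phi> (br l0 l0)" using M4_act_l_surj by blast
  have "\<pi> (l0 + \<psi> v) = e2_l" by (simp add: \<Pi>.add l0)
  moreover have "br (l0 + \<psi> v) (l0 + \<psi> v) = 0"
    using ll0 by (simp add: br_\<psi>_left l0 v \<Psi>.neg)
  ultimately show ?thesis by blast
qed

lemma exists_left_eigen_lift:
  assumes "\<pi> (br l x0) = c *s \<pi> x0" and "c \<noteq> 0"
  shows "\<exists>x. \<pi> x = \<pi> x0 \<and> br l x = sc c x"
proof -
  define x where "x = sc (inverse c) (br l x0)"
  have \<pi>_x: "\<pi> x = \<pi> x0" using assms by (simp add: x_def \<Pi>.scale)
  then have "x - x0 \<in> I" by (simp add: mem_I_iff \<Pi>.diff)
  then have "br l x = br l x0" using br_I_right[of "x - x0" l] by simp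
  also have "\<dots> = sc c x" using assms(2) by (simp add: x_def)
  finally show ?thesis using \<pi>_x by blast
qed

lemma right_eigen_of_left_eigen:
  assumes ll: "br l l = 0" and lx: "br l x = sc c x" and "c \<noteq> 0"
  shows "br x l = - sc c x"
proof -
  have "br x l + br l x \<in> I" \<comment> \<open>\<open>L/I\<close> is a Lie algebra\<close>
    by (simp add: mem_I_iff \<Pi>.add \<pi>_br vec_eq_iff forall_3 algebra_simps)
  then have "br l (br x l) = - sc c (sc c x)"
    using br_I_right[of _ l] lx by (metis br_bilinear(2,10) add_eq_0_iff2)
  moreover have "sc c (br x l) = br l (br x l)"
    using leibniz_identity[OF leibniz, of l x l] ll lx by simp
  ultimately have "sc c (br x l) = sc c (- sc c x)" by simp
  with \<open>c \<noteq> 0\<close> show ?thesis using \<Pi>.vs1.scale_cancel_left by blast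
qed

lemma adapted_lifts:
  obtains l p q where "\<pi> l = e2_l" "\<pi> p = e2_pp" "\<pi> q = e2_pm"
    "br l l = 0" "br l p = p" "br p l = - p" "br l q = - q" "br q l = q"
    "br p p = 0" "br p q = 0" "br q p = 0" "br q q = 0"
proof -
  obtain l where l: "\<pi> l = e2_l" "br l l = 0"
    using exists_lift_l by blast
  obtain p0 q0 where p0: "\<pi> p0 = e2_pp" and q0: "\<pi> q0 = e2_pm"
    using surj_\<pi> by (metis surjD)
  have "\<pi> (br l p0) = 1 *s \<pi> p0" "\<pi> (br l q0) = (-1) *s \<pi> q0"
    by (simp_all add: \<pi>_br l p0 q0 vec_eq_iff forall_3)
  then obtain p q where p: "\<pi> p = e2_pp" "br l p = sc 1 p"
    and q: "\<pi> q = e2_pm" "br l q = sc (-1) q"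
    using exists_left_eigen_lift p0 q0 by (metis zero_neq_one neg_equal_0_iff_equal)
  have pl: "br p l = sc (-1) p" and ql: "br q l = sc 1 q"
    using right_eigen_of_left_eigen[OF l(2) p(2)] right_eigen_of_left_eigen[OF l(2) q(2)]
    by simp_all
  have in_I: "br p p \<in> I" "br p q \<in> I" "br q p \<in> I" "br q q \<in> I"
    by (simp_all add: mem_I_iff \<pi>_br p(1) q(1) vec_eq_iff forall_3)
  have "br p p = 0" "br p q = 0" "br q p = 0" "br q q = 0"
    by (rule I_weight_vanishes[OF in_I(1) l(1) leibniz_weight_add[OF leibniz pl pl]]
      I_weight_vanishes[OF in_I(2) l(1) leibniz_weight_add[OF leibniz pl ql]]
      I_weight_vanishes[OF in_I(3) l(1) leibniz_weight_add[OF leibniz ql pl]]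
      I_weight_vanishes[OF in_I(4) l(1) leibniz_weight_add[OF leibniz ql ql]]; simp add: field_simps)+
  with l p q pl ql show thesis
    using that by simp
qed

definition adapted_basis :: "'a \<Rightarrow> 'a \<Rightarrow> 'a \<Rightarrow> nat \<Rightarrow> 'a" where
  "adapted_basis l p q k = [l, p, q, \<psi> (vector [1, 0, 0, 0]), \<psi> (vector [0, 1, 0, 0]),
     \<psi> (vector [0, 0, 1, 0]), \<psi> (vector [0, 0, 0, 1])] ! k"

lemma adapted_basis_combination:
  "(\<Sum>k\<in>{0..<7}. sc (c k) (adapted_basis l p q k))
     = sc (c 0) l + sc (c 1) p + sc (c 2) q + \<psi> (vector [c 3, c 4, c 5, c 6])"
proof -
  have "vector [c 3, c 4, c 5, c 6] = c 3 *s vector [1, 0, 0, 0] + c 4 *s vector [0, 1, 0, 0]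
      + c 5 *s vector [0, 0, 1, 0] + (c 6 *s vector [0, 0, 0, 1] :: complex^4)"
    by (simp add: vec_eq_iff forall_4)
  then show ?thesis
    by (simp add: adapted_basis_def eval_nat_numeral \<Psi>.add \<Psi>.scale add.assoc)
qed

lemma adapted_basis_unique_coefficients:
  assumes "\<pi> l = e2_l" "\<pi> p = e2_pp" "\<pi> q = e2_pm"
    and zero: "(\<Sum>k\<in>{0..<7}. sc (c k) (adapted_basis l p q k)) = 0"
  shows "\<forall>k\<in>{0..<7}. c k = 0"
proof -
  have combination: "sc (c 0) l + sc (c 1) p + sc (c 2) q + \<psi> (vector [c 3, c 4, c 5, c 6]) = 0"
    using zero by (simp add: adapted_basis_combination)
  then have "\<pi> (sc (c 0) l + sc (c 1) p + sc (c 2) q + \<psi> (vector [c 3, c 4, c 5, c 6])) = 0"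
    by simp
  then have "c 0 = 0" "c 1 = 0" "c 2 = 0"
    using assms(1-3) by (simp_all add: \<Pi>.add \<Pi>.scale vec_eq_iff forall_3)
  with combination have "vector [c 3, c 4, c 5, c 6] = (0 :: complex^4)"
    by simp
  then have "c 3 = 0" "c 4 = 0" "c 5 = 0" "c 6 = 0"
    by (simp_all add: vec_eq_iff forall_4)
  with \<open>c 0 = 0\<close> \<open>c 1 = 0\<close> \<open>c 2 = 0\<close> show ?thesis
    by (auto dest!: less_7_cases)
qed

lemma adapted_basis_span:
  assumes "\<pi> l = e2_l" "\<pi> p = e2_pp" "\<pi> q = e2_pm"
  shows "module.span sc (adapted_basis l p q ` {0..<7}) = UNIV"
proof -
  have "x \<in> module.span sc (adapted_basis l p q ` {0..<7})" for x
  proof -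
    define c where "c = \<pi> x"
    define i where "i = x - (sc (c$1) l + sc (c$2) p + sc (c$3) q)"
    have "i \<in> I"
      using assms by (simp add: mem_I_iff i_def c_def \<Pi>.diff \<Pi>.add \<Pi>.scale vec_eq_iff forall_3)
    define v where "v = \<phi> i"
    have "vector [v$1, v$2, v$3, v$4] = v"
      by (simp add: vec_eq_iff forall_4)
    then have "\<psi> (vector [v$1, v$2, v$3, v$4]) = i"
      using \<psi>_\<phi>[OF \<open>i \<in> I\<close>] by (simp add: v_def)
    then have "x = (\<Sum>k\<in>{0..<7}. sc ([c$1, c$2, c$3, v$1, v$2, v$3, v$4] ! k) (adapted_basis l p q k))"
      unfolding adapted_basis_combination by (simp add: i_def)
    also have "\<dots> \<in> module.span sc (adapted_basis l p q ` {0..<7})"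
      by (intro \<Pi>.vs1.span_sum \<Pi>.vs1.span_scale \<Pi>.vs1.span_base imageI)
    finally show ?thesis .
  qed
  then show ?thesis by blast
qed

lemma adapted_basis_table:
  assumes "\<pi> l = e2_l" "\<pi> p = e2_pp" "\<pi> q = e2_pm"
    and "br l l = 0" "br l p = p" "br p l = - p" "br l q = - q" "br q l = q"
    and "br p p = 0" "br p q = 0" "br q p = 0" "br q q = 0"
  shows "\<forall>i<7. \<forall>j<7. br (adapted_basis l p q i) (adapted_basis l p q j)
           = target_table sc (adapted_basis l p q) i j"
proof (intro allI impI)
  fix i j :: nat assume "i < 7" "j < 7"
  show "br (adapted_basis l p q i) (adapted_basis l p q j) = target_table sc (adapted_basis l p q) i j"
    using less_7_cases[OF \<open>i < 7\<close>] less_7_cases[OF \<open>j < 7\<close>]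
    by (elim disjE) (simp_all add: assms adapted_basis_def target_table_def br_\<psi>_left
        \<Psi>.scale[symmetric] \<Psi>.neg[symmetric] vec_eq_iff forall_4)
qed

lemma adapted_basis_exists:
  "\<exists>b :: nat \<Rightarrow> 'a.
     inj_on b {0..<7} \<and>
     \<not> module.dependent sc (b ` {0..<7}) \<and>
     module.span sc (b ` {0..<7}) = UNIV \<and>
     (\<forall>k\<in>{3..<7}. b k \<in> I) \<and>
     (\<forall>i<7. \<forall>j<7. br (b i) (b j) = target_table sc b i j)"
proof -
  obtain l p q where lifts: "\<pi> l = e2_l" "\<pi> p = e2_pp" "\<pi> q = e2_pm"
    and products: "br l l = 0" "br l p = p" "br p l = - p" "br l q = - q" "br q l = q"
      "br p p = 0" "br p q = 0" "br q p = 0" "br q q = 0"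
    by (rule adapted_lifts)
  let ?b = "adapted_basis l p q"
  have unique: "\<forall>k\<in>{0..<7}. c k = 0" if "(\<Sum>k\<in>{0..<7}. sc (c k) (?b k)) = 0" for c
    using adapted_basis_unique_coefficients[OF lifts that] .
  have "inj_on ?b {0..<7}"
    using \<Pi>.vs1.unique_coefficients_imp_inj_on[of "{0..<7}"] unique by blast
  moreover have "\<not> module.dependent sc (?b ` {0..<7})"
    using \<Pi>.vs1.unique_coefficients_imp_independent[of "{0..<7}"] unique by blast
  moreover have "module.span sc (?b ` {0..<7}) = UNIV"
    using adapted_basis_span[OF lifts] .
  moreover have "\<forall>k\<in>{3..<7}. ?b k \<in> I"
    by (auto simp: adapted_basis_def \<psi>_in_I dest!: less_7_cases)
  moreover have "\<forall>i<7. \<forall>j<7. br (?b i) (?b j) = target_table sc ?b i j"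
    using adapted_basis_table[OF lifts products] .
  ultimately show ?thesis by blast
qed

end

theorem mainTheorem6:
  fixes sc :: "complex \<Rightarrow> 'a::ab_group_add \<Rightarrow> 'a"
    and br :: "'a \<Rightarrow> 'a \<Rightarrow> 'a"
  assumes leib: "leibniz_algebra sc br"
    and quot: "\<exists>\<pi> :: 'a \<Rightarrow> complex^3.
       Vector_Spaces.linear sc (*s) \<pi> \<and> surj \<pi> \<and>
       {x. \<pi> x = 0} = square_ideal sc br \<and>
       (\<forall>x y. \<pi> (br x y) = e2_br (\<pi> x) (\<pi> y)) \<and>
       (\<exists>\<phi> :: 'a \<Rightarrow> complex^4.
          bij_betw \<phi> (square_ideal sc br) UNIV \<and>
          (\<forall>i\<in>square_ideal sc br. \<forall>j\<in>square_ideal sc br. \<phi> (i + j) = \<phi> i + \<phi> j) \<and>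
          (\<forall>c. \<forall>i\<in>square_ideal sc br. \<phi> (sc c i) = c *s \<phi> i) \<and>
          (\<forall>i\<in>square_ideal sc br. \<forall>x. \<phi> (br i x) = M4_act (\<phi> i) (\<pi> x)))"
  shows "\<exists>b :: nat \<Rightarrow> 'a.
           inj_on b {0..<7} \<and>
           \<not> module.dependent sc (b ` {0..<7}) \<and>
           module.span sc (b ` {0..<7}) = UNIV \<and>
           (\<forall>k\<in>{3..<7}. b k \<in> square_ideal sc br) \<and>
           (\<forall>i<7. \<forall>j<7. br (b i) (b j) = target_table sc b i j)"
proof -
  from quot obtain \<pi> :: "'a \<Rightarrow> complex^3" and \<phi> :: "'a \<Rightarrow> complex^4"
    where "leibniz_e2_M4 sc br \<pi> \<phi>"
    using leib unfolding leibniz_e2_M4_def by blast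
  then show ?thesis by (rule leibniz_e2_M4.adapted_basis_exists)
qed

end
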